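(* Let $\mathbb{X}$ be a reflexive Banach space and $\mathbb{Y}$ an arbitrary Banach space, and suppose $\mathbb{K}(\mathbb{X},\mathbb{Y})$ is an $M$-ideal in $\mathbb{L}(\mathbb{X},\mathbb{Y})$. Let $T\in\mathbb{L}(\mathbb{X},\mathbb{Y})$ with $\|T\|=1$ be such that $\operatorname{dist}(T,\mathbb{K}(\mathbb{X},\mathbb{Y}))<1$ and $M_T\cap \operatorname{Ext}(B_{\mathbb{X}})=\{\pm x_1,\pm x_2,\ldots,\pm x_r\}$, where $\{x_1,\ldots,x_r\}$ is linearly independent in $\mathbb{X}$. Suppose $Tx_i$ is $m_i$-smooth for each $1\leq i\leq r$. Then $T$ is $k$-smooth, where $k=m_1+m_2+\cdots+m_r$.
   Context: $\mathbb{L}(\mathbb{X},\mathbb{Y})$ ($\mathbb{K}(\mathbb{X},\mathbb{Y})$) is the space of bounded (compact) linear operators with the operator norm. $B_{\mathbb{X}}$ is the closed unit ball, $\operatorname{Ext}(B_{\mathbb{X}})$ its set of extreme points, and $M_T=\{x\in\mathbb{X}:\|x\|=1,\ \|Tx\|=\|T\|\}$. A subspace $M$ of a Banach space $\mathbb{Z}$ is an $M$-ideal if there is a projection $P$ on $\mathbb{Z}^*$ with $P(\mathbb{Z}^* )=\{z^*\in\mathbb{Z}^*:z^*(m)=0\ \forall m\in M\}$ and $\|z^*\|=\|Pz^*\|+\|z^*-Pz^*\|$ for all $z^*\in\mathbb{Z}^*$. For a Banach space $\mathbb{Z}$ and a unit vector $z$, $J(z)=\{f\in \mathbb{Z}^*:\|f\|=1,\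 f(z)=1\}$; $z$ is $k$-smooth if $\dim\operatorname{span} J(z)=k$ (applied to $\mathbb{Z}=\mathbb{Y}$ for $Tx_i$ and to $\mathbb{Z}=\mathbb{L}(\mathbb{X},\mathbb{Y})$ for $T$). *)

theory Defs
  imports "HOL-Analysis.Analysis"
begin

definition reflexive_space :: "'a::banach itself \<Rightarrow> bool" where
  "reflexive_space _ \<longleftrightarrow>
     (\<forall>\<phi> :: ('a \<Rightarrow>\<^sub>L real) \<Rightarrow>\<^sub>L real. \<exists>x::'a. \<forall>f. blinfun_apply \<phi> f = blinfun_apply f x)"

definition compact_ops :: "('a::real_normed_vector \<Rightarrow>\<^sub>L 'b::real_normed_vector) set" where
  "compact_ops = {T. compact (closure (blinfun_apply T ` cball 0 1))}"

definition M_ideal :: "'z::real_normed_vector set \<Rightarrow> bool" where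
  "M_ideal M \<longleftrightarrow> subspace M \<and>
     (\<exists>P :: ('z \<Rightarrow>\<^sub>L real) \<Rightarrow> ('z \<Rightarrow>\<^sub>L real).
        linear P \<and> P \<circ> P = P \<and>
        range P = {f. \<forall>m\<in>M. blinfun_apply f m = 0} \<and>
        (\<forall>f. norm f = norm (P f) + norm (f - P f)))"

definition norm_attain_set :: "('a::real_normed_vector \<Rightarrow>\<^sub>L 'b::real_normed_vector) \<Rightarrow> 'a set" where
  "norm_attain_set T = {x. norm x = 1 \<and> norm (blinfun_apply T x) = norm T}"

definition support_functionals :: "'z::real_normed_vector \<Rightarrow> ('z \<Rightarrow>\<^sub>L real) set" where
  "support_functionals z = {f. norm f = 1 \<and> blinfun_apply f z = 1}"

definition k_smooth :: "'z::real_normed_vector \<Rightarrow> nat \<Rightarrow> bool" where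
  "k_smooth z k \<longleftrightarrow> norm z = 1 \<and>
     (\<exists>B. finite B \<and> span B = span (support_functionals z)) \<and>
     dim (span (support_functionals z)) = k"

end

theory Submission
  imports Defs
begin

text \<open>
  Since dist(T, K(X,Y)) < 1, the M-ideal projection P kills every support functional of T.
  Given F in J(T) and any operator S, take almost norming pairs (z_n, y_n) for T + t_n S with
  t_n tending to 0. A cluster point of the functionals y_n \<otimes> z_n lies in J(T), and on compact
  operators it agrees with y \<otimes> z for weak cluster points y, z; being killed by P it has no other
  extension from the compact operators of norm at most 1, so it equals y \<otimes> z. Hence
  F(S) \<le> y(Sz) with y(Tz) = 1, and maximizing y \<circ> S over the face {z. y(Tz) = 1} of the weakly
  compact unit ball makes z extreme, that is z = \<plusminus>x_i. So a compact S killed by all of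
  x_i \<otimes> J(Tx_i) is killed by F, and F lies in the (finite-dimensional) span of these sets.
  Functionals biorthogonal to the x_i show that the sum of these spans is direct.
\<close>

subsection \<open>Norming functionals\<close>

text \<open>Homogeneity is demanded only as \<open>\<le>\<close>, which is what infima deliver;
  scaling back by \<open>1/c\<close> recovers equality.\<close>

definition sublinear :: "('a::real_vector \<Rightarrow> real) \<Rightarrow> bool" where
  "sublinear p \<longleftrightarrow> (\<forall>x y. p (x + y) \<le> p x + p y) \<and> (\<forall>c\<ge>0. \<forall>x. p (c *\<^sub>R x) \<le> c * p x)"

lemma sublinear_add: "sublinear p \<Longrightarrow> p (x + y) \<le> p x + p y"
  by (simp add: sublinear_def)

lemma sublinear_scale_le: "sublinear p \<Longrightarrow> c \<ge> 0 \<Longrightarrow> p (c *\<^sub>R x) \<le> c * p x"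
  by (simp add: sublinear_def)

lemma sublinear_zero:
  assumes "sublinear p" shows "p 0 = 0"
  using sublinear_add[OF assms, of 0 0] sublinear_scale_le[OF assms, of 0 0] by simp

lemma sublinear_scale:
  assumes "sublinear p" "c \<ge> 0" shows "p (c *\<^sub>R x) = c * p x"
proof (cases "c = 0")
  case False
  then have "c > 0" using assms by simp
  then have "p x \<le> (1/c) * p (c *\<^sub>R x)"
    using sublinear_scale_le[OF assms(1), of "1/c" "c *\<^sub>R x"] by simp
  then have "c * p x \<le> p (c *\<^sub>R x)" using \<open>c > 0\<close> by (simp add: field_simps)
  then show ?thesis using sublinear_scale_le[OF assms, of x] by simp
qed (simp add: sublinear_zero[OF assms(1)])

lemma sublinear_minus:
  assumes "sublinear p" shows "- p (- x) \<le> p x"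
  using sublinear_add[OF assms, of x "- x"] sublinear_zero[OF assms] by simp

text \<open>Serves infima over shifts and over Zorn chains. The index \<open>k\<close> may vary with
  the arguments: the infimum is bounded by every right-hand side, and then infima over
  \<open>i\<close> and \<open>j\<close> are taken one after the other.\<close>

lemma sublinear_INF:
  fixes p :: "'i \<Rightarrow> 'a::real_vector \<Rightarrow> real"
  assumes ne: "I \<noteq> {}" and bdd: "\<And>x. bdd_below ((\<lambda>i. p i x) ` I)"
    and add: "\<And>i j x y. i \<in> I \<Longrightarrow> j \<in> I \<Longrightarrow> \<exists>k\<in>I. p k (x + y) \<le> p i x + p j y"
    and scale: "\<And>i c x. i \<in> I \<Longrightarrow> c > 0 \<Longrightarrow> \<exists>k\<in>I. p k (c *\<^sub>R x) \<le> c * p i x"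
    and zero: "\<exists>k\<in>I. p k 0 \<le> 0"
  shows "sublinear (\<lambda>x. INF i\<in>I. p i x)"
proof -
  let ?u = "\<lambda>x. INF i\<in>I. p i x"
  have low: "?u x \<le> p i x" if "i \<in> I" for i x
    using that bdd by (rule cINF_lower[rotated])
  have "?u (x + y) \<le> ?u x + ?u y" for x y
  proof -
    have 1: "?u (x + y) \<le> p i x + p j y" if "i \<in> I" "j \<in> I" for i j
      using add[OF that, of x y] low by (meson order_trans)
    have "?u (x + y) - p i x \<le> ?u y" if "i \<in> I" for i
      using 1[OF that] by (intro cINF_greatest[OF ne]) (simp add: algebra_simps)
    then have "?u (x + y) - ?u y \<le> ?u x"
      by (intro cINF_greatest[OF ne]) (simp add: algebra_simps)
    then show ?thesis by simp
  qed
  moreover have "?u (c *\<^sub>R x) \<le> c * ?u x" if "c \<ge> 0" for c x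
  proof (cases "c = 0")
    case True
    then show ?thesis using zero low[of _ 0] by (auto intro: order_trans)
  next
    case False
    then have "c > 0" using that by simp
    have "?u (c *\<^sub>R x) / c \<le> ?u x"
    proof (intro cINF_greatest[OF ne])
      fix i assume "i \<in> I"
      then have "?u (c *\<^sub>R x) \<le> c * p i x"
        using scale[OF _ \<open>c > 0\<close>, of i x] low by (meson order_trans)
      then show "?u (c *\<^sub>R x) / c \<le> p i x" using \<open>c > 0\<close> by (simp add: field_simps)
    qed
    then show ?thesis using \<open>c > 0\<close> by (simp add: field_simps)
  qed
  ultimately show ?thesis by (simp add: sublinear_def)
qed

text \<open>This makes a minimal sublinear functional odd, hence linear.\<close>

lemma sublinear_lower_at:
  fixes p :: "'a::real_vector \<Rightarrow> real"
  assumes p: "sublinear p"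
  shows "\<exists>q. sublinear q \<and> q \<le> p \<and> q (- y) \<le> - p y"
proof -
  \<comment> \<open>Subtracting \<open>t * p y\<close> compensates the shift. The value
    \<open>t = 0\<close> makes the infimum a minorant of \<open>p\<close>; \<open>t = 1\<close> at
    \<open>- y\<close> gives \<open>p 0 - p y = - p y\<close>.\<close>
  define h where "h t x = p (x + t *\<^sub>R y) - t * p y" for t x
  let ?q = "\<lambda>x. INF t\<in>{0..}. h t x"
  have bdd: "bdd_below ((\<lambda>t. h t x) ` {0..})" for x
  proof (rule bdd_belowI2)
    fix t :: real assume "t \<in> {0..}"
    then have "t * p y = p ((x + t *\<^sub>R y) + (- x))" using sublinear_scale[OF p, of t y] by simp
    also have "\<dots> \<le> p (x + t *\<^sub>R y) + p (- x)" by (rule sublinear_add[OF p])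
    finally show "- p (- x) \<le> h t x" by (simp add: h_def)
  qed
  have low: "?q x \<le> h t x" if "t \<ge> 0" for t x
    using that by (intro cINF_lower[OF bdd]) simp
  have "sublinear ?q"
  proof (rule sublinear_INF[OF _ bdd])
    fix s t x z assume "s \<in> {0::real..}" "t \<in> {0::real..}"
    moreover have "h (s + t) (x + z) \<le> h s x + h t z"
      using sublinear_add[OF p, of "x + s *\<^sub>R y" "z + t *\<^sub>R y"]
      by (simp add: h_def algebra_simps)
    ultimately show "\<exists>k\<in>{0..}. h k (x + z) \<le> h s x + h t z"
      by (intro bexI[of _ "s + t"]) auto
  next
    fix t c :: real and x assume "t \<in> {0..}" "c > 0"
    moreover have "h (c * t) (c *\<^sub>R x) = c * h t x"
      using sublinear_scale[OF p, of c "x + t *\<^sub>R y"] \<open>c > 0\<close>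
      by (simp add: h_def algebra_simps)
    ultimately show "\<exists>k\<in>{0..}. h k (c *\<^sub>R x) \<le> c * h t x"
      by (intro bexI[of _ "c * t"]) auto
  next
    show "\<exists>k\<in>{0..}. h k 0 \<le> 0"
      using sublinear_zero[OF p] by (intro bexI[of _ 0]) (auto simp: h_def)
  qed auto
  moreover have "?q x \<le> p x" for x using low[of 0 x] by (simp add: h_def)
  moreover have "?q (- y) \<le> - p y"
    using low[of 1 "- y"] sublinear_zero[OF p] by (simp add: h_def)
  ultimately show ?thesis by (intro exI[of _ ?q]) (auto simp: le_fun_def)
qed

text \<open>Hahn-Banach in minorant form. Zorn's lemma runs on the reversed order, so its maximal
  element is a minimal sublinear functional.\<close>

lemma linear_below_sublinear:
  fixes p0 :: "'a::real_vector \<Rightarrow> real"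
  assumes p0: "sublinear p0"
  shows "\<exists>f. linear f \<and> f \<le> p0"
proof -
  let ?A = "{p. sublinear p \<and> p \<le> p0}"
  let ?P = "\<lambda>p q::'a \<Rightarrow> real. q \<le> p"
  have "\<exists>m\<in>?A. \<forall>a\<in>?A. ?P m a \<longrightarrow> a = m"
  proof (rule predicate_Zorn)
    show "partial_order_on ?A (relation_of ?P ?A)"
      by (rule partial_order_on_relation_ofI) auto
  next
    fix C assume C: "C \<in> Chains (relation_of ?P ?A)"
    then have CA: "C \<subseteq> ?A" and chain: "\<And>p q. p \<in> C \<Longrightarrow> q \<in> C \<Longrightarrow> p \<le> q \<or> q \<le> p"
      by (auto simp: Chains_def relation_of_def)
    show "\<exists>u\<in>?A. \<forall>a\<in>C. ?P a u"
    proof (cases "C = {}")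
      case True
      then show ?thesis using p0 by auto
    next
      case False
      let ?u = "\<lambda>x. INF p\<in>C. p x"
      \<comment> \<open>The members of the chain share the bound \<open>- p0 (- x)\<close>, since
        \<open>- p (- x) \<le> p x\<close> and \<open>p \<le> p0\<close>.\<close>
      have bdd: "bdd_below ((\<lambda>p. p x) ` C)" for x
      proof (rule bdd_belowI2)
        fix p assume "p \<in> C"
        then have "sublinear p" "p \<le> p0" using CA by auto
        then show "- p0 (- x) \<le> p x"
          using sublinear_minus[of p x] by (auto simp: le_fun_def dest!: spec[of _ "- x"])
      qed
      have low: "?u x \<le> p x" if "p \<in> C" for p x
        using that bdd by (rule cINF_lower[rotated])
      have "sublinear ?u"
      proof (rule sublinear_INF[OF False bdd])
        fix p q x y assume pq: "p \<in> C" "q \<in> C"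
        show "\<exists>k\<in>C. k (x + y) \<le> p x + q y"
        proof (cases "p \<le> q")
          case True
          then show ?thesis using pq CA sublinear_add[of p x y] le_funD[OF True, of y]
            by (intro bexI[of _ p]) auto
        next
          case False
          then have "q \<le> p" using chain[OF pq] by auto
          then show ?thesis using pq CA sublinear_add[of q x y] le_funD[OF \<open>q \<le> p\<close>, of x]
            by (intro bexI[of _ q]) auto
        qed
      next
        fix p c x assume "p \<in> C" "(0::real) < c"
        then show "\<exists>k\<in>C. k (c *\<^sub>R x) \<le> c * p x"
          using CA sublinear_scale_le[of p c x] by auto
      next
        show "\<exists>k\<in>C. k 0 \<le> 0" using False CA sublinear_zero by fastforce
      qed
      moreover have "?u \<le> p" if "p \<in> C" for p using low[OF that] by (simp add: le_fun_def)
      moreover have "?u \<le> p0"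
      proof -
        obtain p where "p \<in> C" using False by auto
        then have "p \<le> p0" "?u \<le> p" using CA low by (auto simp: le_fun_def)
        then show ?thesis by (rule order_trans[rotated])
      qed
      ultimately show ?thesis by (intro bexI[of _ ?u]) auto
    qed
  qed
  then obtain f where f: "sublinear f" "f \<le> p0"
    and minimal: "\<And>q. sublinear q \<Longrightarrow> q \<le> p0 \<Longrightarrow> q \<le> f \<Longrightarrow> q = f" by auto
  have neg: "f (- y) = - f y" for y
  proof -
    obtain q where q: "sublinear q" "q \<le> f" "q (- y) \<le> - f y"
      using sublinear_lower_at[OF f(1)] by blast
    then have "q = f" using minimal f(2) by (meson order_trans)
    then show ?thesis using q(3) sublinear_minus[OF f(1), of y] by simp
  qed
  \<comment> \<open>Oddness turns subadditivity at \<open>- x\<close> and \<open>- y\<close> into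
    superadditivity at \<open>x\<close> and \<open>y\<close>.\<close>
  have "f (x + y) = f x + f y" for x y
    using sublinear_add[OF f(1), of x y] sublinear_add[OF f(1), of "- x" "- y"]
      neg[of "x + y"] by (simp add: neg)
  moreover have "f (c *\<^sub>R x) = c *\<^sub>R f x" for c x
  proof (cases "c \<ge> 0")
    case True
    then show ?thesis using sublinear_scale[OF f(1)] by simp
  next
    case False
    then have "f ((- c) *\<^sub>R x) = (- c) * f x" by (intro sublinear_scale[OF f(1)]) simp
    then show ?thesis using neg[of "c *\<^sub>R x"] by simp
  qed
  ultimately have "linear f" by (intro linearI) auto
  then show ?thesis using f(2) by blast
qed

text \<open>Lowering \<open>norm\<close> at \<open>x\<close> before taking a linear minorant
  \<open>g\<close> forces \<open>g (- x) \<le> - norm x\<close>, so \<open>g x\<close> cannot fall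
  below \<open>norm x\<close>.\<close>

lemma norming_functional:
  fixes x :: "'a::real_normed_vector"
  obtains f :: "'a \<Rightarrow>\<^sub>L real" where "norm f \<le> 1" "f x = norm x"
proof -
  have "sublinear (norm :: 'a \<Rightarrow> real)"
    by (simp add: sublinear_def norm_triangle_ineq)
  then obtain q where q: "sublinear q" "q \<le> norm" "q (- x) \<le> - norm x"
    using sublinear_lower_at by blast
  obtain g where g: "linear g" "g \<le> q" using linear_below_sublinear[OF q(1)] by blast
  have le: "g y \<le> norm y" for y using g(2) q(2) by (meson le_funD order_trans)
  have abs: "\<bar>g y\<bar> \<le> norm y" for y
    using le[of y] le[of "- y"] by (simp add: linear_neg[OF g(1)])
  then have "bounded_linear g"
    using g(1) by (auto simp: bounded_linear_def bounded_linear_axioms_def intro!: exI[of _ 1])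
  then have app: "blinfun_apply (Blinfun g) = g" by (rule bounded_linear_Blinfun_apply)
  have "norm (Blinfun g) \<le> 1" by (rule norm_blinfun_bound) (auto simp: app abs)
  moreover have "g x = norm x"
    using le_funD[OF g(2), of "- x"] q(3) le[of x] by (simp add: linear_neg[OF g(1)])
  ultimately show thesis using that app by metis
qed

lemma blinfun_separates_points:
  fixes x y :: "'a::real_normed_vector"
  assumes "\<And>f::'a \<Rightarrow>\<^sub>L real. f x = f y"
  shows "x = y"
proof -
  obtain f :: "'a \<Rightarrow>\<^sub>L real" where "f (x - y) = norm (x - y)"
    using norming_functional by blast
  then show ?thesis using assms[of f] by (simp add: blinfun.diff_right)
qed

subsection \<open>Weak compactness\<close>

text \<open>Banach-Alaoglu: functions carry the product topology, so Tychonoff makes the box of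
  values compact, and linearity cuts out a closed subset.\<close>

lemma compact_dual_ball:
  "compact {\<phi>::'a::real_normed_vector \<Rightarrow> real. linear \<phi> \<and> (\<forall>x. \<bar>\<phi> x\<bar> \<le> norm x)}"
proof -
  let ?box = "PiE UNIV (\<lambda>x::'a. cball (0::real) (norm x))"
  have cont: "continuous_on UNIV (\<lambda>\<phi>::'a \<Rightarrow> real. \<phi> x)" for x
    by simp
  have "compactin (product_topology (\<lambda>_. euclidean) UNIV) ?box"
    by (subst compactin_PiE) auto
  then have "compact ?box"
    by (simp add: euclidean_product_topology)
  moreover have "closed ((\<Inter>x. \<Inter>y. {\<phi>::'a \<Rightarrow> real. \<phi> (x + y) = \<phi> x + \<phi> y}) \<inter>
      (\<Inter>c. \<Inter>x. {\<phi>::'a \<Rightarrow> real. \<phi> (c *\<^sub>R x) = c *\<^sub>R \<phi> x}))"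
    by (intro closed_Int closed_INT ballI closed_Collect_eq continuous_intros cont)
  ultimately have "compact (?box \<inter> ((\<Inter>x. \<Inter>y. {\<phi>::'a \<Rightarrow> real. \<phi> (x + y) = \<phi> x + \<phi> y}) \<inter>
      (\<Inter>c. \<Inter>x. {\<phi>::'a \<Rightarrow> real. \<phi> (c *\<^sub>R x) = c *\<^sub>R \<phi> x})))"
    by (rule compact_Int_closed)
  also have "\<dots> = {\<phi>::'a \<Rightarrow> real. linear \<phi> \<and> (\<forall>x. \<bar>\<phi> x\<bar> \<le> norm x)}"
    by (auto simp: linear_iff PiE_UNIV_domain)
  finally show ?thesis .
qed

lemma blinfun_of_dual_ball:
  fixes \<phi> :: "'a::real_normed_vector \<Rightarrow> real"
  assumes "linear \<phi>" "\<And>x. \<bar>\<phi> x\<bar> \<le> norm x"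
  obtains f :: "'a \<Rightarrow>\<^sub>L real" where "blinfun_apply f = \<phi>" "norm f \<le> 1"
proof -
  have "bounded_linear \<phi>"
    using assms by (auto simp: bounded_linear_def bounded_linear_axioms_def intro!: exI[of _ 1])
  then have app: "blinfun_apply (Blinfun \<phi>) = \<phi>" by (rule bounded_linear_Blinfun_apply)
  moreover have "norm (Blinfun \<phi>) \<le> 1"
    by (rule norm_blinfun_bound) (auto simp: app assms)
  ultimately show thesis using that by blast
qed

lemma abs_blinfun_le:
  fixes f :: "'a::real_normed_vector \<Rightarrow>\<^sub>L real"
  assumes "norm f \<le> 1" shows "\<bar>f x\<bar> \<le> norm x"
  using norm_blinfun[of f x] mult_right_mono[OF assms norm_ge_zero[of x]] by simp

lemma linear_blinfun_apply: "linear (blinfun_apply f)"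
  by (intro bounded_linear.linear blinfun.bounded_linear_right)

text \<open>Finer filters play the part of subnets: weak topologies need not be metrizable, so
  convergent subsequences cannot be expected.\<close>

lemma compact_refine_filter:
  assumes "compact A" "F \<noteq> bot" "\<And>i. h i \<in> A"
  obtains l G where "l \<in> A" "G \<le> F" "G \<noteq> bot" "(h \<longlongrightarrow> l) G"
proof -
  have "filtermap h F \<noteq> bot" using assms(2) by (simp add: filtermap_bot_iff)
  moreover have "eventually (\<lambda>x. x \<in> A) (filtermap h F)" using assms(3) by (simp add: eventually_filtermap)
  ultimately obtain l where l: "l \<in> A" "inf (nhds l) (filtermap h F) \<noteq> bot"
    using assms(1) unfolding compact_filter by meson
  \<comment> \<open>The coarsest filter below \<open>F\<close> along which \<open>h\<close> tends to
    \<open>l\<close>; it is proper because \<open>l\<close> is a cluster point.\<close>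
  let ?G = "inf (filtercomap h (nhds l)) F"
  have "?G \<noteq> bot"
  proof
    assume "?G = bot"
    then have "eventually (\<lambda>_. False) ?G" by simp
    then obtain P Q where PQ: "eventually P (filtercomap h (nhds l))" "eventually Q F"
      "\<And>x. P x \<Longrightarrow> Q x \<Longrightarrow> False" unfolding eventually_inf by metis
    then obtain P' where P': "eventually P' (nhds l)" "\<And>x. P' (h x) \<Longrightarrow> P x"
      unfolding eventually_filtercomap by blast
    have "eventually (\<lambda>y. \<not> P' y) (filtermap h F)"
      unfolding eventually_filtermap using PQ(2) by (rule eventually_mono) (use PQ(3) P'(2) in blast)
    then have "eventually (\<lambda>_. False) (inf (nhds l) (filtermap h F))"
      unfolding eventually_inf using P'(1) by blast
    then show False using l(2) by (simp add: trivial_limit_def)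
  qed
  moreover have "(h \<longlongrightarrow> l) ?G"
    using filterlim_filtercomap by (rule filterlim_mono) auto
  ultimately show thesis using that[of l ?G] l(1) by simp
qed

lemma tendsto_fun_component:
  fixes h :: "'i \<Rightarrow> 'a \<Rightarrow> 'b::topological_space"
  assumes "(h \<longlongrightarrow> l) F"
  shows "((\<lambda>i. h i x) \<longlongrightarrow> l x) F"
  using continuous_on_tendsto_compose[OF continuous_on_product_coordinates assms, of x] by simp

lemma compact_imp_closed_fun:
  fixes S :: "('a \<Rightarrow> 'b::metric_space) set"
  assumes "compact S" shows "closed S"
proof -
  have "Hausdorff_space (product_topology (\<lambda>_::'a. euclidean :: 'b topology) UNIV)"
    by (simp add: Hausdorff_space_product_topology)
  then show ?thesis
    using assms compactin_imp_closedin[of euclidean S]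
    by (simp add: euclidean_product_topology)
qed

lemma closed_fun_coordinate_eq: "closed {\<phi>::'a \<Rightarrow> real. \<phi> x = c}"
proof -
  have "continuous_on UNIV (\<lambda>\<phi>::'a \<Rightarrow> real. \<phi> x)" by simp
  then show ?thesis using continuous_on_const by (rule closed_Collect_eq)
qed

lemma bounded_functionals_cluster_point:
  fixes f :: "'i \<Rightarrow> 'a::real_normed_vector \<Rightarrow>\<^sub>L real"
  assumes "F \<noteq> bot" "\<And>i. norm (f i) \<le> 1"
  obtains l G where "norm l \<le> 1" "G \<le> F" "G \<noteq> bot" "\<And>x. ((\<lambda>i. f i x) \<longlongrightarrow> blinfun_apply l x) G"
proof -
  have "blinfun_apply (f i) \<in> {\<phi>. linear \<phi> \<and> (\<forall>x. \<bar>\<phi> x\<bar> \<le> norm x)}" for i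
    by (simp add: abs_blinfun_le assms(2) linear_blinfun_apply)
  then obtain \<phi> G where \<phi>: "\<phi> \<in> {\<phi>. linear \<phi> \<and> (\<forall>x. \<bar>\<phi> x\<bar> \<le> norm x)}"
    and G: "G \<le> F" "G \<noteq> bot" "((\<lambda>i. blinfun_apply (f i)) \<longlongrightarrow> \<phi>) G"
    by (rule compact_refine_filter[OF compact_dual_ball assms(1)])
  obtain l :: "'a \<Rightarrow>\<^sub>L real" where "blinfun_apply l = \<phi>" "norm l \<le> 1"
    using \<phi> by (auto intro: blinfun_of_dual_ball)
  then show thesis using that[of l G] G tendsto_fun_component[OF G(3)] by simp
qed

text \<open>For real codomain this is the canonical embedding into the bidual; the general codomain
  serves evaluation of operators.\<close>

lift_definition eval_blinfun :: "'a::real_normed_vector \<Rightarrow> ('a \<Rightarrow>\<^sub>L 'b::real_normed_vector) \<Rightarrow>\<^sub>L 'b"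
  is "\<lambda>x f. blinfun_apply f x"
  by (rule blinfun.bounded_linear_left)

lemma norm_eval_blinfun: "norm (eval_blinfun x) \<le> norm x"
  by (rule norm_blinfun_bound) (use norm_blinfun in \<open>auto simp: eval_blinfun.rep_eq mult.commute\<close>)

text \<open>Reduces weak compactness of a reflexive ball to Banach-Alaoglu for the bidual. A norming
  functional shows that the vector representing \<open>\<phi>\<close> has norm at most 1.\<close>

lemma reflexive_cball_image:
  assumes "reflexive_space TYPE('a::banach)"
  shows "(\<lambda>x (g::'a \<Rightarrow>\<^sub>L real). g x) ` cball (0::'a) 1
    = {\<phi>::('a \<Rightarrow>\<^sub>L real) \<Rightarrow> real. linear \<phi> \<and> (\<forall>g. \<bar>\<phi> g\<bar> \<le> norm g)}"
proof (intro equalityI subsetI)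
  fix \<phi> assume "\<phi> \<in> (\<lambda>x (g::'a \<Rightarrow>\<^sub>L real). g x) ` cball (0::'a) 1"
  then obtain x :: 'a where x: "norm x \<le> 1" "\<phi> = blinfun_apply (eval_blinfun x)"
    by (auto simp: eval_blinfun.rep_eq)
  have "norm (eval_blinfun x :: ('a \<Rightarrow>\<^sub>L real) \<Rightarrow>\<^sub>L real) \<le> 1"
    using norm_eval_blinfun x(1) by (rule order_trans)
  then show "\<phi> \<in> {\<phi>. linear \<phi> \<and> (\<forall>g. \<bar>\<phi> g\<bar> \<le> norm g)}"
    by (simp add: x(2) abs_blinfun_le linear_blinfun_apply)
next
  fix \<phi> :: "('a \<Rightarrow>\<^sub>L real) \<Rightarrow> real" assume "\<phi> \<in> {\<phi>. linear \<phi> \<and> (\<forall>g. \<bar>\<phi> g\<bar> \<le> norm g)}"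
  then have \<phi>: "linear \<phi>" "\<And>g. \<bar>\<phi> g\<bar> \<le> norm g" by auto
  obtain l :: "('a \<Rightarrow>\<^sub>L real) \<Rightarrow>\<^sub>L real" where l: "blinfun_apply l = \<phi>" "norm l \<le> 1"
    using \<phi> by (auto intro: blinfun_of_dual_ball)
  obtain x :: 'a where x: "\<And>g. l g = g x" using assms unfolding reflexive_space_def by blast
  obtain g :: "'a \<Rightarrow>\<^sub>L real" where "norm g \<le> 1" "g x = norm x" using norming_functional by blast
  then have "norm x \<le> 1" using \<phi>(2)[of g] x[of g] l(1) by simp
  moreover have "\<phi> = blinfun_apply l" using l by simp
  ultimately show "\<phi> \<in> (\<lambda>x (g::'a \<Rightarrow>\<^sub>L real). g x) ` cball (0::'a) 1"
    using x by (intro image_eqI[of _ _ x]) auto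
qed

lemma reflexive_compact_cball_image:
  assumes "reflexive_space TYPE('a::banach)"
  shows "compact ((\<lambda>x g::'a \<Rightarrow>\<^sub>L real. blinfun_apply g x) ` cball (0::'a) 1)"
  unfolding reflexive_cball_image[OF assms] by (rule compact_dual_ball)

lemma reflexive_weak_cluster_point:
  fixes z :: "'i \<Rightarrow> 'a::banach"
  assumes "reflexive_space TYPE('a)" "F \<noteq> bot" "\<And>i. norm (z i) \<le> 1"
  obtains l G where "norm l \<le> 1" "G \<le> F" "G \<noteq> bot"
    "\<And>g::'a \<Rightarrow>\<^sub>L real. ((\<lambda>i. g (z i)) \<longlongrightarrow> g l) G"
proof -
  obtain \<phi> G where \<phi>: "\<phi> \<in> (\<lambda>x g::'a \<Rightarrow>\<^sub>L real. blinfun_apply g x) ` cball (0::'a) 1"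
    and G: "G \<le> F" "G \<noteq> bot" "((\<lambda>i g::'a \<Rightarrow>\<^sub>L real. blinfun_apply g (z i)) \<longlongrightarrow> \<phi>) G"
    by (rule compact_refine_filter[OF reflexive_compact_cball_image[OF assms(1)] assms(2),
          of "\<lambda>i g. blinfun_apply g (z i)"]) (use assms(3) in auto)
  obtain l where l: "norm l \<le> 1" "\<phi> = (\<lambda>g. blinfun_apply g l)" using \<phi> by auto
  show thesis
    by (rule that[OF l(1) G(1,2)]) (use tendsto_fun_component[OF G(3)] l(2) in simp)
qed

subsection \<open>Extreme points of faces of a reflexive ball\<close>

text \<open>When a proper convex combination of two values at most \<open>c\<close> equals
  \<open>c\<close>, both deficits \<open>c - g a\<close> and \<open>c - g b\<close> vanish.\<close>

lemma face_of_argmax: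
  fixes D :: "'a::real_normed_vector set" and g :: "'a \<Rightarrow>\<^sub>L real"
  assumes "convex D" and max: "\<And>z. z \<in> D \<Longrightarrow> g z \<le> c"
  shows "{z\<in>D. g z = c} face_of D"
proof -
  have "convex {z\<in>D. g z = c}"
    unfolding convex_def
  proof (intro ballI allI impI)
    fix a b and u v :: real
    assume *: "a \<in> {z\<in>D. g z = c}" "b \<in> {z\<in>D. g z = c}" "u \<ge> 0" "v \<ge> 0" "u + v = 1"
    then have "u *\<^sub>R a + v *\<^sub>R b \<in> D" using assms(1) by (auto simp: convex_def)
    moreover have "u * c + v * c = c" using *(5) by (metis distrib_right mult_1)
    ultimately show "u *\<^sub>R a + v *\<^sub>R b \<in> {z\<in>D. g z = c}"
      using * by (simp add: blinfun.add_right blinfun.scaleR_right)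
  qed
  moreover have "a \<in> {z\<in>D. g z = c} \<and> b \<in> {z\<in>D. g z = c}"
    if *: "a \<in> D" "b \<in> D" "z \<in> {z\<in>D. g z = c}" "z \<in> open_segment a b" for a b z
  proof -
    obtain u where u: "0 < u" "u < 1" "z = (1 - u) *\<^sub>R a + u *\<^sub>R b"
      using *(4) by (auto simp: in_segment)
    have eq: "(1 - u) * g a + u * g b = c"
      using *(3) u(3) by (simp add: blinfun.add_right blinfun.scaleR_right)
    have le: "g a \<le> c" "g b \<le> c" using * max by auto
    have "(1 - u) * (c - g a) + u * (c - g b) = 0" using eq by (simp add: algebra_simps)
    moreover have "(1 - u) * (c - g a) \<ge> 0" "u * (c - g b) \<ge> 0" using le u by auto
    ultimately have "(1 - u) * (c - g a) = 0" "u * (c - g b) = 0" by linarith+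
    then show ?thesis using u * by auto
  qed
  ultimately show ?thesis unfolding face_of_def by blast
qed

text \<open>The Krein-Milman argument: on a minimal nonempty compact face every functional is
  constant, and functionals separate points. The map \<open>e\<close> turns the weak topology into
  the product topology.\<close>

lemma weakly_compact_face_has_extreme_point:
  fixes S :: "'a::real_normed_vector set"
  defines "e \<equiv> \<lambda>x (g::'a \<Rightarrow>\<^sub>L real). g x"
  assumes D0: "D0 face_of S" "D0 \<noteq> {}" "compact (e ` D0)"
  obtains z where "z \<in> D0" "z extreme_point_of S"
proof -
  have inj: "inj e"
    by (rule injI) (metis (no_types, lifting) blinfun_separates_points e_def)
  let ?A = "{D. D \<subseteq> D0 \<and> D \<noteq> {} \<and> D face_of S \<and> compact (e ` D)}"
  have "\<exists>M\<in>?A. \<forall>D\<in>?A. D \<subseteq> M \<longrightarrow> D = M"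
  proof (rule predicate_Zorn)
    show "partial_order_on ?A (relation_of (\<lambda>M D. D \<subseteq> M) ?A)"
      by (rule partial_order_on_relation_ofI) auto
  next
    fix C assume C: "C \<in> Chains (relation_of (\<lambda>M D. D \<subseteq> M) ?A)"
    then have CA: "C \<subseteq> ?A" and chain: "\<And>p q. p \<in> C \<Longrightarrow> q \<in> C \<Longrightarrow> p \<subseteq> q \<or> q \<subseteq> p"
      by (auto simp: Chains_def relation_of_def)
    show "\<exists>u\<in>?A. \<forall>a\<in>C. u \<subseteq> a"
    proof (cases "C = {}")
      case True
      then show ?thesis using D0 by auto
    next
      case False
      have "(\<Inter>D\<in>C. e ` D) \<noteq> {}"
      proof -
        obtain D1 where D1: "D1 \<in> C" using False by auto
        have "e ` D1 \<inter> (\<Inter>D\<in>C. e ` D) \<noteq> {}"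
        proof (rule compact_imp_fip_image)
          show "compact (e ` D1)" using D1 CA by auto
          show "closed (e ` D)" if "D \<in> C" for D using that CA by (auto intro: compact_imp_closed_fun)
          fix I' assume I': "finite I'" "I' \<subseteq> C"
          \<comment> \<open>Finitely many members of a chain contain a common member of it, which
            gives the finite intersection property.\<close>
          have "\<exists>D\<in>C. D \<subseteq> D1 \<inter> \<Inter>I'" using I'
          proof (induction I')
            case empty
            then show ?case using D1 by auto
          next
            case (insert E I')
            then obtain D where D: "D \<in> C" "D \<subseteq> D1 \<inter> \<Inter>I'" by auto
            then show ?case using chain[of D E] insert(4) by (metis Int_subset_iff Inter_insert insert_subset order.trans order_refl)
          qed
          then obtain D where "D \<in> C" "D \<subseteq> D1 \<inter> \<Inter>I'" by blast
          moreover from this obtain z where "z \<in> D" using CA by blast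
          ultimately have "e z \<in> e ` D1 \<inter> (\<Inter>D\<in>I'. e ` D)" by blast
          then show "e ` D1 \<inter> (\<Inter>D\<in>I'. e ` D) \<noteq> {}" by blast
        qed
        then show ?thesis by blast
      qed
      moreover have "(\<Inter>D\<in>C. e ` D) = e ` \<Inter>C"
        using image_INT[of e UNIV C "\<lambda>D. D"] inj False by (metis image_ident subset_UNIV ex_in_conv)
      moreover have "compact (\<Inter>D\<in>C. e ` D)"
      proof -
        obtain D1 where D1: "D1 \<in> C" using False by auto
        have "closed (\<Inter>D\<in>C. e ` D)"
          by (rule closed_INT) (use CA in \<open>auto intro: compact_imp_closed_fun\<close>)
        moreover have "compact (e ` D1)" using D1 CA by auto
        ultimately have "compact (e ` D1 \<inter> (\<Inter>D\<in>C. e ` D))" by (metis compact_Int_closed)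
        moreover have "e ` D1 \<inter> (\<Inter>D\<in>C. e ` D) = (\<Inter>D\<in>C. e ` D)" using D1 by blast
        ultimately show ?thesis by simp
      qed
      moreover have "\<Inter>C face_of S" using False CA by (intro face_of_Inter) auto
      moreover have "\<Inter>C \<subseteq> D0" using False CA by auto
      ultimately show ?thesis by (intro bexI[of _ "\<Inter>C"]) auto
    qed
  qed
  then obtain M where MA: "M \<in> ?A" and min: "\<forall>D\<in>?A. D \<subseteq> M \<longrightarrow> D = M"
    by (rule bexE)
  then have M: "M \<subseteq> D0" "M \<noteq> {}" "M face_of S" "compact (e ` M)" by simp_all
  have minimal: "D = M"
    if "D \<subseteq> D0" "D \<noteq> {}" "D face_of S" "compact (e ` D)" "D \<subseteq> M" for D
    using bspec[OF min, of D] that by simp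
  have const: "g a = g b" if "a \<in> M" "b \<in> M" for a b and g :: "'a \<Rightarrow>\<^sub>L real"
  proof -
    have "\<exists>\<phi>\<in>e ` M. \<forall>\<psi>\<in>e ` M. \<psi> g \<le> \<phi> g"
      using M by (intro continuous_attains_sup continuous_on_subset[OF continuous_on_product_coordinates]) auto
    then obtain z where z: "z \<in> M" "\<And>w. w \<in> M \<Longrightarrow> g w \<le> g z" by (auto simp: e_def)
    \<comment> \<open>The points of \<open>M\<close> where \<open>g\<close> is largest form a
      compact subface; by minimality it is all of \<open>M\<close>.\<close>
    let ?D = "{w\<in>M. g w = g z}"
    have "convex M" using M(3) by (rule face_of_imp_convex)
    then have "?D face_of S" using face_of_argmax[of M g "g z"] z(2) M(3) face_of_trans by blast
    moreover have "compact (e ` ?D)"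
    proof -
      have "e ` ?D = e ` M \<inter> {\<phi>. \<phi> g = g z}" by (auto simp: e_def)
      then show ?thesis using compact_Int_closed[OF M(4) closed_fun_coordinate_eq[of g "g z"]] by simp
    qed
    ultimately have "?D = M" using minimal[of ?D] M(1) z(1) by auto
    then show ?thesis using that by (metis (mono_tags, lifting) mem_Collect_eq)
  qed
  obtain z where "z \<in> M" using M(2) by blast
  then have "M = {z}" using blinfun_separates_points[OF const] by blast
  then show thesis using that M by (metis face_of_singleton singletonI subsetD)
qed

text \<open>Two nested argmax faces, first for \<open>g\<close>, then for \<open>h\<close>. Since
  \<open>z0\<close> lies in the first, any extreme point of the second does at least as well under
  \<open>h\<close>.\<close>

lemma reflexive_face_maximizer:
  fixes g h :: "'a::banach \<Rightarrow>\<^sub>L real"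
  assumes refl: "reflexive_space TYPE('a)"
    and g: "\<And>z. norm z \<le> 1 \<Longrightarrow> g z \<le> c" and z0: "norm z0 \<le> 1" "g z0 = c"
  obtains z where "z extreme_point_of cball 0 1" "g z = c" "h z0 \<le> h z"
proof -
  let ?e = "\<lambda>x (g::'a \<Rightarrow>\<^sub>L real). g x"
  let ?D = "{z\<in>cball 0 1. g z = c}"
  have face: "?D face_of cball 0 1" using g by (intro face_of_argmax) auto
  have "?e ` ?D = ?e ` cball 0 1 \<inter> {\<phi>. \<phi> g = c}" by auto
  then have comp: "compact (?e ` ?D)"
    using compact_Int_closed[OF reflexive_compact_cball_image[OF refl] closed_fun_coordinate_eq[of g c]]
    by simp
  have "\<exists>\<phi>\<in>?e ` ?D. \<forall>\<psi>\<in>?e ` ?D. \<psi> h \<le> \<phi> h"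
    using comp z0 by (intro continuous_attains_sup continuous_on_subset[OF continuous_on_product_coordinates]) auto
  then obtain z1 where z1: "z1 \<in> ?D" "\<And>w. w \<in> ?D \<Longrightarrow> h w \<le> h z1" by auto
  let ?E = "{z\<in>?D. h z = h z1}"
  have "?E face_of ?D" using face_of_imp_convex[OF face] z1(2) by (rule face_of_argmax)
  then have "?E face_of cball 0 1" using face by (rule face_of_trans)
  moreover have "?e ` ?E = ?e ` ?D \<inter> {\<phi>. \<phi> h = h z1}" by auto
  then have "compact (?e ` ?E)" using compact_Int_closed[OF comp closed_fun_coordinate_eq[of h "h z1"]] by simp
  ultimately obtain z where "z \<in> ?E" "z extreme_point_of cball 0 1"
    using weakly_compact_face_has_extreme_point[of ?E "cball 0 1"] z1(1) by blast
  then show thesis using that[of z] z1(2)[of z0] z0 by auto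
qed

subsection \<open>Finite families of functionals\<close>

text \<open>On the kernel of a new functional \<open>h\<close> the remaining ones suffice, and one
  multiple of \<open>h\<close> corrects the rest. \<open>K\<close> is left general so that the
  induction can pass to this kernel.\<close>

lemma functional_in_span:
  fixes F :: "'z::real_normed_vector \<Rightarrow>\<^sub>L real"
  assumes "finite B" "subspace K"
    and "\<And>s. s \<in> K \<Longrightarrow> (\<And>g. g \<in> B \<Longrightarrow> blinfun_apply g s = 0) \<Longrightarrow> F s = 0"
  shows "\<exists>g\<in>span B. \<forall>s\<in>K. F s = g s"
  using assms
proof (induction B arbitrary: K rule: finite_induct)
  case empty
  then show ?case by (intro bexI[of _ 0]) (auto simp: span_zero)
next
  case (insert h B)
  have "subspace {s. h s = 0}"
    by (auto simp: subspace_def blinfun.add_right blinfun.scaleR_right)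
  then have "subspace (K \<inter> {s. h s = 0})" using insert.prems(1) by (simp add: subspace_inter)
  then obtain g where g: "g \<in> span B" "\<And>s. s \<in> K \<Longrightarrow> h s = 0 \<Longrightarrow> F s = g s"
    using insert.IH[of "K \<inter> {s. h s = 0}"] insert.prems(2) by auto
  have gB: "g \<in> span (insert h B)" using g(1) span_mono[of B "insert h B"] by auto
  show ?case
  proof (cases "\<exists>s\<in>K. h s \<noteq> 0")
    case False
    then show ?thesis using g gB by blast
  next
    case True
    then obtain s0 where s0: "s0 \<in> K" "h s0 \<noteq> 0" by blast
    \<comment> \<open>Chosen so that \<open>F\<close> and \<open>g + c *\<^sub>R h\<close> agree at
      \<open>s0\<close>; subtracting a multiple of \<open>s0\<close> moves any \<open>s\<close> into
      the kernel of \<open>h\<close>.\<close>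
    define c where "c = (F s0 - g s0) / h s0"
    have "F s = (g + c *\<^sub>R h) s" if "s \<in> K" for s
    proof -
      let ?s = "s - (h s / h s0) *\<^sub>R s0"
      have "?s \<in> K" using that s0(1) insert.prems(1) by (intro subspace_diff subspace_scale)
      moreover have "h ?s = 0" using s0(2) by (simp add: blinfun.diff_right blinfun.scaleR_right)
      ultimately have "F ?s = g ?s" by (rule g(2))
      then show ?thesis using s0(2)
        by (simp add: blinfun.diff_right blinfun.scaleR_right blinfun.add_left blinfun.scaleR_left
            c_def field_simps)
    qed
    moreover have "g + c *\<^sub>R h \<in> span (insert h B)"
      using gB by (intro span_add span_scale) (auto intro: span_base)
    ultimately show ?thesis by blast
  qed
qed

lemma linear_eval_blinfun: "linear eval_blinfun"
  by (rule linearI) (auto intro!: blinfun_eqI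
      simp: eval_blinfun.rep_eq blinfun.add_right blinfun.scaleR_right blinfun.add_left blinfun.scaleR_left)

text \<open>Otherwise evaluation at \<open>x i\<close> vanishes wherever the other evaluations do,
  hence lies in their span; separation of points then puts \<open>x i\<close> in the span of the
  other vectors.\<close>

lemma biorthogonal_functional:
  fixes x :: "'i \<Rightarrow> 'a::real_normed_vector"
  assumes fin: "finite I" and inj: "inj_on x I" and ind: "independent (x ` I)" and i: "i \<in> I"
  obtains a :: "'a \<Rightarrow>\<^sub>L real" where "a (x i) = 1" "\<And>j. j \<in> I \<Longrightarrow> j \<noteq> i \<Longrightarrow> a (x j) = 0"
proof -
  let ?ev = "eval_blinfun :: 'a \<Rightarrow> ('a \<Rightarrow>\<^sub>L real) \<Rightarrow>\<^sub>L real"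
  let ?X = "x ` (I - {i})"
  have X: "?X = x ` I - {x i}" using inj i by (auto simp: inj_on_def)
  have "\<exists>a::'a \<Rightarrow>\<^sub>L real. (\<forall>g\<in>?ev ` ?X. g a = 0) \<and> ?ev (x i) a \<noteq> 0"
  proof (rule ccontr)
    assume "\<not> ?thesis"
    then have "\<exists>g\<in>span (?ev ` ?X). \<forall>s\<in>UNIV. ?ev (x i) s = g s"
      using fin by (intro functional_in_span) auto
    moreover have "span (?ev ` ?X) = ?ev ` span ?X"
      using linear_eval_blinfun by (rule linear_span_image)
    ultimately obtain s where s: "s \<in> span ?X" "\<And>f. ?ev (x i) f = ?ev s f"
      by (metis UNIV_I imageE)
    have "x i = s"
    proof (rule blinfun_separates_points)
      show "f (x i) = f s" for f :: "'a \<Rightarrow>\<^sub>L real"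
        using s(2)[of f] by (simp add: eval_blinfun.rep_eq)
    qed
    then have "x i \<in> span (x ` I - {x i})" using s(1) X by simp
    then show False using ind i by (auto simp: dependent_def)
  qed
  then obtain a :: "'a \<Rightarrow>\<^sub>L real" where a: "\<And>j. j \<in> I \<Longrightarrow> j \<noteq> i \<Longrightarrow> a (x j) = 0" "a (x i) \<noteq> 0"
    by (auto simp: eval_blinfun.rep_eq)
  show thesis
    by (rule that[of "(1 / a (x i)) *\<^sub>R a"]) (use a in \<open>auto simp: blinfun.scaleR_left\<close>)
qed

text \<open>Directness, tested on families with one or two nonzero entries, makes each
  \<open>\<phi> i\<close> injective and the images disjoint, so bases unite without
  collisions.\<close>

lemma direct_sum_independent:
  fixes \<phi> :: "'i \<Rightarrow> 'v::real_vector \<Rightarrow> 'w::real_vector"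
  assumes I: "finite I" and lin: "\<And>i. i \<in> I \<Longrightarrow> linear (\<phi> i)"
    and direct: "\<And>c i. (\<Sum>i\<in>I. \<phi> i (c i)) = 0 \<Longrightarrow> i \<in> I \<Longrightarrow> c i = 0"
    and fin: "\<And>i. i \<in> I \<Longrightarrow> finite (B i)" and ind: "\<And>i. i \<in> I \<Longrightarrow> independent (B i)"
  shows "independent (\<Union>i\<in>I. \<phi> i ` B i)" "card (\<Union>i\<in>I. \<phi> i ` B i) = (\<Sum>i\<in>I. card (B i))"
proof -
  have inj: "inj_on (\<phi> i) A" if "i \<in> I" for i A
  proof -
    have "b = 0" if b: "\<phi> i b = 0" for b
    proof -
      let ?c = "\<lambda>k. if k = i then b else 0"
      have "(\<Sum>k\<in>I. \<phi> k (?c k)) = 0"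
        by (intro sum.neutral) (auto simp: b linear_0[OF lin])
      then show "b = 0" using direct[of ?c i] \<open>i \<in> I\<close> by simp
    qed
    then have "inj (\<phi> i)" using linear_injective_0[OF lin[OF that]] by blast
    then show ?thesis by (rule inj_on_subset) simp
  qed
  have disj: "\<phi> i ` B i \<inter> \<phi> j ` B j = {}" if ij: "i \<in> I" "j \<in> I" "i \<noteq> j" for i j
  proof (rule ccontr)
    assume "\<phi> i ` B i \<inter> \<phi> j ` B j \<noteq> {}"
    then obtain b b' where b: "b \<in> B i" "b' \<in> B j" "\<phi> i b = \<phi> j b'" by auto
    let ?c = "\<lambda>k. if k = i then b else if k = j then - b' else 0"
    have "(\<Sum>k\<in>I. \<phi> k (?c k)) = (\<Sum>k\<in>{i,j}. \<phi> k (?c k))"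
      using I ij by (intro sum.mono_neutral_right) (auto simp: linear_0[OF lin])
    also have "\<dots> = 0" using ij b(3) by (simp add: linear_neg[OF lin])
    finally have "b = 0" using direct[of ?c i] ij by simp
    then show False using b(1) ind[OF ij(1)] dependent_zero by blast
  qed
  have sums: "(\<Sum>w\<in>(\<Union>i\<in>I. \<phi> i ` B i). h w) = (\<Sum>i\<in>I. \<Sum>b\<in>B i. h (\<phi> i b))"
    for h :: "'w \<Rightarrow> 'c::comm_monoid_add"
  proof -
    have "(\<Sum>w\<in>(\<Union>i\<in>I. \<phi> i ` B i). h w) = (\<Sum>i\<in>I. \<Sum>w\<in>\<phi> i ` B i. h w)"
      using I fin disj by (intro sum.UNION_disjoint) auto
    also have "\<dots> = (\<Sum>i\<in>I. \<Sum>b\<in>B i. h (\<phi> i b))"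
      by (intro sum.cong refl) (simp add: sum.reindex[OF inj])
    finally show ?thesis .
  qed
  show "card (\<Union>i\<in>I. \<phi> i ` B i) = (\<Sum>i\<in>I. card (B i))"
    using sums[of "\<lambda>_. 1::nat"] by simp
  show "independent (\<Union>i\<in>I. \<phi> i ` B i)"
  proof (rule independent_if_scalars_zero)
    show "finite (\<Union>i\<in>I. \<phi> i ` B i)" using I fin by auto
    fix u w assume u: "(\<Sum>w\<in>(\<Union>i\<in>I. \<phi> i ` B i). u w *\<^sub>R w) = 0" and "w \<in> (\<Union>i\<in>I. \<phi> i ` B i)"
    then obtain i b where ib: "i \<in> I" "b \<in> B i" "w = \<phi> i b" by auto
    \<comment> \<open>The linear relation is grouped by \<open>i\<close>; directness makes each
      group vanish before \<open>\<phi> i\<close> is applied, where \<open>B i\<close> is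
      independent.\<close>
    let ?c = "\<lambda>i. \<Sum>b\<in>B i. u (\<phi> i b) *\<^sub>R b"
    have "(\<Sum>i\<in>I. \<phi> i (?c i)) = (\<Sum>i\<in>I. \<Sum>b\<in>B i. u (\<phi> i b) *\<^sub>R \<phi> i b)"
      by (intro sum.cong refl) (simp add: linear_sum[OF lin] linear_scale[OF lin])
    then have "?c i = 0" using u ib direct[of ?c i] by (simp add: sums)
    then show "u w = 0"
      using independentD[OF ind[OF ib(1)] fin[OF ib(1)] subset_refl, of "\<lambda>b. u (\<phi> i b)" b] ib
      by simp
  qed
qed

subsection \<open>Functionals evaluating an operator at a point\<close>

text \<open>The elementary tensor \<open>f \<otimes> x\<close>, sending an operator \<open>A\<close>
  to \<open>f (A x)\<close>.\<close>

abbreviation point_functional ::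
  "'a::real_normed_vector \<Rightarrow> ('b::real_normed_vector \<Rightarrow>\<^sub>L real) \<Rightarrow> ('a \<Rightarrow>\<^sub>L 'b) \<Rightarrow>\<^sub>L real" where
  "point_functional x f \<equiv> f o\<^sub>L eval_blinfun x"

lemma linear_point_functional: "linear (point_functional x)"
  by (rule linearI) (auto intro!: blinfun_eqI simp: blinfun.add_left blinfun.scaleR_left)

lemma norm_point_functional_le_1:
  fixes x :: "'a::real_normed_vector" and f :: "'b::real_normed_vector \<Rightarrow>\<^sub>L real"
  assumes "norm x \<le> 1" "norm f \<le> 1"
  shows "norm (point_functional x f) \<le> 1"
proof -
  have "norm f * norm (eval_blinfun x :: ('a \<Rightarrow>\<^sub>L 'b) \<Rightarrow>\<^sub>L 'b) \<le> 1 * 1"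
    using assms norm_eval_blinfun[of x] by (intro mult_mono) (auto intro: order_trans)
  then show ?thesis using order_trans[OF norm_blinfun_compose] by simp
qed

text \<open>Limits only come with norm at most 1; the value 1 forces equality in
  \<open>1 \<le> norm f * norm z\<close>.\<close>

lemma support_functionalsI:
  assumes "norm f \<le> 1" "norm z \<le> 1" "blinfun_apply f z = 1"
  shows "f \<in> support_functionals z" "norm z = 1"
proof -
  have 1: "1 \<le> norm f * norm z" using norm_blinfun[of f z] assms(3) by simp
  have "norm f * norm z \<le> 1 * norm z" using assms(1) by (rule mult_right_mono) simp
  moreover have "norm f * norm z \<le> norm f * 1" using assms(2) by (rule mult_left_mono) simp
  ultimately show "norm z = 1" "f \<in> support_functionals z"
    using 1 assms by (auto simp: support_functionals_def)
qed

lemma point_functional_support: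
  assumes "norm T = 1" "norm x \<le> 1" "f \<in> support_functionals (blinfun_apply T x)"
  shows "point_functional x f \<in> support_functionals T"
  using assms norm_point_functional_le_1[of x f]
  by (intro support_functionalsI(1)) (auto simp: support_functionals_def eval_blinfun.rep_eq)

text \<open>Rank-one operators built from a functional biorthogonal to the \<open>x j\<close>
  isolate a single summand.\<close>

lemma point_functionals_direct:
  fixes x :: "'i \<Rightarrow> 'a::real_normed_vector" and f :: "'i \<Rightarrow> 'b::real_normed_vector \<Rightarrow>\<^sub>L real"
  assumes fin: "finite I" and inj: "inj_on x I" and ind: "independent (x ` I)" and i: "i \<in> I"
    and zero: "(\<Sum>i\<in>I. point_functional (x i) (f i)) = 0"
  shows "f i = 0"
proof (rule blinfun_eqI)
  fix y :: 'b
  obtain a :: "'a \<Rightarrow>\<^sub>L real" where a: "a (x i) = 1" "\<And>j. j \<in> I \<Longrightarrow> j \<noteq> i \<Longrightarrow> a (x j) = 0"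
    using biorthogonal_functional[OF fin inj ind i] by blast
  let ?A = "blinfun_scaleR_left y o\<^sub>L a"
  have "0 = (\<Sum>i\<in>I. point_functional (x i) (f i)) ?A" by (simp add: zero)
  also have "\<dots> = (\<Sum>j\<in>I. f j (a (x j) *\<^sub>R y))" by (simp add: blinfun.sum_left eval_blinfun.rep_eq)
  also have "\<dots> = (\<Sum>j\<in>I. if j = i then f i y else 0)"
    using a by (intro sum.cong) auto
  also have "\<dots> = f i y" using fin i by simp
  finally show "f i y = blinfun_apply 0 y" by simp
qed

lemma almost_norming_pair:
  fixes A :: "'a::real_normed_vector \<Rightarrow>\<^sub>L 'b::real_normed_vector"
  assumes "\<epsilon> > 0"
  obtains z and f :: "'b \<Rightarrow>\<^sub>L real" where "norm z \<le> 1" "norm f \<le> 1" "norm A - \<epsilon> \<le> f (A z)"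
proof -
  have "\<exists>z. norm z \<le> 1 \<and> norm A - \<epsilon> \<le> norm (A z)"
  proof (rule ccontr)
    assume "\<not> ?thesis"
    then have less: "norm (A z) < norm A - \<epsilon>" if "norm z \<le> 1" for z using that by force
    \<comment> \<open>The zero vector supplies the nonnegativity that a bound on the operator norm
      must have.\<close>
    have pos: "0 < norm A - \<epsilon>" using less[of 0] by simp
    have "norm A \<le> norm A - \<epsilon>"
    proof (rule norm_blinfun_bound)
      fix x
      show "norm (A x) \<le> (norm A - \<epsilon>) * norm x"
      proof (cases "x = 0")
        case False
        then have "norm (A ((1 / norm x) *\<^sub>R x)) < norm A - \<epsilon>" by (intro less) simp
        then show ?thesis using False by (simp add: blinfun.scaleR_right field_simps)
      qed simp
    qed (use pos in simp)
    then show False using assms by simp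
  qed
  then obtain z where z: "norm z \<le> 1" "norm A - \<epsilon> \<le> norm (A z)" by blast
  obtain f :: "'b \<Rightarrow>\<^sub>L real" where "norm f \<le> 1" "f (A z) = norm (A z)"
    using norming_functional by blast
  then show thesis using that[of z f] z by simp
qed

text \<open>Two weak convergences alone do not control \<open>f i (A (z i))\<close>. Compactness
  makes \<open>A (z i)\<close> converge in norm along a finer filter, and the bounded functionals
  \<open>f i\<close> then pass to the limit.\<close>

lemma compact_op_weak_limit:
  fixes A :: "'a::real_normed_vector \<Rightarrow>\<^sub>L 'b::real_normed_vector"
    and f :: "'i \<Rightarrow> 'b \<Rightarrow>\<^sub>L real"
  assumes A: "A \<in> compact_ops" and F: "F \<noteq> bot"
    and z: "\<And>i. norm (z i) \<le> 1" "\<And>g::'a \<Rightarrow>\<^sub>L real. ((\<lambda>i. g (z i)) \<longlongrightarrow> g z') F"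
    and f: "\<And>i. norm (f i) \<le> 1" "\<And>y. ((\<lambda>i. f i y) \<longlongrightarrow> blinfun_apply f' y) F"
    and lim: "((\<lambda>i. f i (A (z i))) \<longlongrightarrow> l) F"
  shows "l = f' (A z')"
proof -
  have "compact (closure (blinfun_apply A ` cball 0 1))" using A by (simp add: compact_ops_def)
  moreover have "A (z i) \<in> closure (blinfun_apply A ` cball 0 1)" for i
    using z(1) by (intro subsetD[OF closure_subset]) auto
  ultimately obtain u G where G: "G \<le> F" "G \<noteq> bot" "((\<lambda>i. A (z i)) \<longlongrightarrow> u) G"
    using compact_refine_filter[of _ F "\<lambda>i. A (z i)"] F by metis
  have "u = A z'"
  proof (rule blinfun_separates_points)
    fix g :: "'b \<Rightarrow>\<^sub>L real"
    have "((\<lambda>i. g (A (z i))) \<longlongrightarrow> g u) G" by (intro blinfun.tendsto tendsto_const G(3))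
    moreover have "((\<lambda>i. g (A (z i))) \<longlongrightarrow> g (A z')) G"
      using tendsto_mono[OF G(1) z(2)[of "g o\<^sub>L A"]] by simp
    ultimately show "g u = g (A z')" using G(2) by (rule tendsto_unique[rotated])
  qed
  have "((\<lambda>i. f i (A (z i) - u)) \<longlongrightarrow> 0) G"
  proof (rule Lim_null_comparison)
    show "((\<lambda>i. norm (A (z i) - u)) \<longlongrightarrow> 0) G"
      using G(3) by (simp add: LIM_zero tendsto_norm_zero)
    show "\<forall>\<^sub>F i in G. norm (f i (A (z i) - u)) \<le> norm (A (z i) - u)"
      using abs_blinfun_le[OF f(1)] by (simp add: always_eventually)
  qed
  then have "((\<lambda>i. f i (A (z i) - u) + f i u) \<longlongrightarrow> 0 + f' u) G"
    by (intro tendsto_add tendsto_mono[OF G(1) f(2)])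
  then have "((\<lambda>i. f i (A (z i))) \<longlongrightarrow> f' u) G" by (simp add: blinfun.diff_right)
  then show ?thesis using tendsto_unique[OF G(2) tendsto_mono[OF G(1) lim]] \<open>u = A z'\<close> by simp
qed

subsection \<open>Support functionals near an M-ideal\<close>

text \<open>Since norms add and \<open>f z = norm f\<close>, both parts of \<open>f\<close> attain
  their norms at \<open>z\<close>. But \<open>P f\<close> kills some \<open>m\<close> at distance
  below 1 from \<open>z\<close>, so its value there is too small unless
  \<open>P f = 0\<close>.\<close>

lemma M_ideal_projection_support:
  fixes P :: "('z::real_normed_vector \<Rightarrow>\<^sub>L real) \<Rightarrow> ('z \<Rightarrow>\<^sub>L real)"
  assumes P: "range P = {f. \<forall>m\<in>M. blinfun_apply f m = 0}"
      "\<And>f. norm f = norm (P f) + norm (f - P f)"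
    and z: "norm z = 1" "M \<noteq> {}" "infdist z M < 1" and f: "f \<in> support_functionals z"
  shows "P f = 0"
proof -
  \<comment> \<open>\<open>infdist\<close> to the empty set is 0 by convention;
    \<open>M \<noteq> {}\<close> makes it a true infimum, so a near point exists.\<close>
  obtain m where m: "m \<in> M" "dist z m < 1"
    using z cInf_lessD[of "(\<lambda>m. dist z m) ` M" 1] by (auto simp: infdist_def)
  have "P f m = 0" using P(1) m(1) by blast
  then have "P f z = P f (z - m)" by (simp add: blinfun.diff_right)
  then have "P f z \<le> norm (P f) * dist z m"
    using norm_blinfun[of "P f" "z - m"] by (simp add: dist_norm)
  moreover have "(f - P f) z \<le> norm (f - P f)"
    using norm_blinfun[of "f - P f" z] z(1) by simp
  moreover have "f z = P f z + (f - P f) z" by (simp add: blinfun.diff_left)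
  ultimately have "norm (P f) \<le> norm (P f) * dist z m"
    using f P(2)[of f] by (simp add: support_functionals_def)
  then have "norm (P f) * (1 - dist z m) \<le> 0" by (simp add: algebra_simps)
  then have "norm (P f) \<le> 0" using m(2) by (simp add: mult_le_0_iff)
  then show ?thesis by simp
qed

text \<open>Because g - f annihilates M, the projection splits g as (g - f) + f, so norms add.\<close>

lemma M_ideal_unique_extension:
  fixes P :: "('z::real_normed_vector \<Rightarrow>\<^sub>L real) \<Rightarrow> ('z \<Rightarrow>\<^sub>L real)"
  assumes P: "linear P" "P \<circ> P = P" "range P = {f. \<forall>m\<in>M. blinfun_apply f m = 0}"
      "\<And>f. norm f = norm (P f) + norm (f - P f)"
    and f: "P f = 0" "\<And>m. m \<in> M \<Longrightarrow> f m = blinfun_apply g m" "norm g \<le> norm f"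
  shows "g = f"
proof -
  have "g - f \<in> range P" unfolding P(3) using f(2) by (simp add: blinfun.diff_left)
  then have "P (g - f) = g - f" using P(2) by (metis comp_apply imageE)
  then have "P g = g - f" using linear_diff[OF P(1), of g f] f(1) by simp
  then have "norm g = norm (g - f) + norm f" using P(4)[of g] by simp
  then show ?thesis using f(3) by simp
qed

text \<open>A one-sided bound at a pair depending on \<open>S\<close> suffices: used for
  \<open>S\<close> and \<open>- S\<close>, it decides where \<open>F\<close> vanishes.\<close>

lemma support_functional_dominated_at_extreme_point:
  fixes T S :: "'a::banach \<Rightarrow>\<^sub>L 'b::real_normed_vector"
    and P :: "(('a \<Rightarrow>\<^sub>L 'b) \<Rightarrow>\<^sub>L real) \<Rightarrow> (('a \<Rightarrow>\<^sub>L 'b) \<Rightarrow>\<^sub>L real)"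
  assumes refl: "reflexive_space TYPE('a)"
    and P: "linear P" "P \<circ> P = P"
      "range P = {f. \<forall>m\<in>(compact_ops :: ('a \<Rightarrow>\<^sub>L 'b) set). blinfun_apply f m = 0}"
      "\<And>f. norm f = norm (P f) + norm (f - P f)"
    and T: "norm T = 1" "infdist T compact_ops < 1" "(compact_ops :: ('a \<Rightarrow>\<^sub>L 'b) set) \<noteq> {}"
    and F: "F \<in> support_functionals T"
  obtains z f where "z extreme_point_of cball 0 1" "z \<in> norm_attain_set T"
    "f \<in> support_functionals (T z)" "F S \<le> f (S z)"
proof -
  \<comment> \<open>The error t^2 below is small against t, so that F S \<le> f n S + t n survives division by t.\<close>
  define t where "t n = 1 / real (Suc n)" for n
  have t: "t n > 0" for n by (simp add: t_def)
  have t0: "t \<longlonglongrightarrow> 0" unfolding t_def by (rule LIMSEQ_Suc[OF lim_1_over_n])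
  have "\<exists>z f. norm z \<le> 1 \<and> norm f \<le> 1 \<and>
      norm (T + t n *\<^sub>R S) - (t n)\<^sup>2 \<le> blinfun_apply f ((T + t n *\<^sub>R S) z)" for n
    using almost_norming_pair[of "(t n)\<^sup>2" "T + t n *\<^sub>R S"] t[of n] by (metis zero_less_power)
  then obtain z y where z: "\<And>n. norm (z n) \<le> 1" and y: "\<And>n. norm (y n) \<le> 1"
    and zy: "\<And>n. norm (T + t n *\<^sub>R S) - (t n)\<^sup>2 \<le> blinfun_apply (y n) ((T + t n *\<^sub>R S) (z n))"
    by metis
  define f where "f n = point_functional (z n) (y n)" for n
  have f: "norm (f n) \<le> 1" for n unfolding f_def using z y by (rule norm_point_functional_le_1)
  have f_sum: "norm (T + t n *\<^sub>R S) - (t n)\<^sup>2 \<le> f n T + t n * f n S" for n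
    using zy[of n] by (simp add: f_def blinfun.add_left blinfun.add_right blinfun.scaleR_left
        blinfun.scaleR_right eval_blinfun.rep_eq)
  have fT: "f n T \<le> 1" for n using abs_blinfun_le[OF f[of n], of T] T(1) by simp
  have normF: "norm F = 1" "F T = 1" using F by (auto simp: support_functionals_def)
  have fS_lower: "F S - t n \<le> f n S" for n
  proof -
    \<comment> \<open>\<open>F\<close> supports \<open>T\<close>, so it bounds the perturbed norm
      from below; \<open>f n T \<le> 1\<close> then cancels the contribution of
      \<open>T\<close>.\<close>
    have "1 + t n * F S \<le> norm (T + t n *\<^sub>R S)"
      using norm_blinfun[of F "T + t n *\<^sub>R S"] normF
      by (simp add: blinfun.add_right blinfun.scaleR_right)
    then have "t n * (F S - t n) \<le> t n * f n S"
      using f_sum[of n] fT[of n] by (simp add: algebra_simps power2_eq_square)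
    then show ?thesis using t[of n] by simp
  qed
  \<comment> \<open>The perturbation costs \<open>norm S * t n\<close> twice, once in the norm and
    once in the value of \<open>f n\<close>.\<close>
  have fT_lower: "1 - 2 * (norm S * t n) - (t n)\<^sup>2 \<le> f n T" for n
  proof -
    have "norm T \<le> norm (T + t n *\<^sub>R S) + norm S * t n"
      using norm_triangle_ineq4[of "T + t n *\<^sub>R S" "t n *\<^sub>R S"] t[of n] by (simp add: mult.commute)
    moreover have "t n * f n S \<le> norm S * t n"
      using abs_blinfun_le[OF f[of n], of S] t[of n] by (simp add: mult.commute)
    ultimately show ?thesis using f_sum[of n] T(1) by linarith
  qed
  have lower: "(\<lambda>n. 1 - 2 * (norm S * t n) - (t n)\<^sup>2) \<longlonglongrightarrow> 1 - 2 * (norm S * 0) - 0\<^sup>2"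
    by (intro tendsto_diff tendsto_mult tendsto_power tendsto_const t0)
  have fT_lim: "(\<lambda>n. f n T) \<longlonglongrightarrow> 1"
  proof (rule tendsto_sandwich)
    show "(\<lambda>n. 1 - 2 * (norm S * t n) - (t n)\<^sup>2) \<longlonglongrightarrow> 1" using lower by simp
    show "(\<lambda>_. 1) \<longlonglongrightarrow> (1::real)" by (rule tendsto_const)
  qed (rule always_eventually, rule allI, rule fT_lower fT)+
  \<comment> \<open>Three successive refinements yield one filter \<open>G\<close> serving the
    limits of \<open>f n\<close>, \<open>y n\<close> and \<open>z n\<close>; that \<open>l\<close>
    is an elementary tensor is shown only afterwards.\<close>
  obtain l G1 where l: "norm l \<le> 1" and G1: "G1 \<le> sequentially" "G1 \<noteq> bot"
      "\<And>A. ((\<lambda>n. f n A) \<longlongrightarrow> blinfun_apply l A) G1"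
    using bounded_functionals_cluster_point[of sequentially f] f by (metis sequentially_bot)
  obtain y' G2 where y': "norm y' \<le> 1" and G2: "G2 \<le> G1" "G2 \<noteq> bot"
      "\<And>v. ((\<lambda>n. y n v) \<longlongrightarrow> blinfun_apply y' v) G2"
    using bounded_functionals_cluster_point[of G1 y] y G1(2) by metis
  obtain z' G where z': "norm z' \<le> 1" and G: "G \<le> G2" "G \<noteq> bot"
      "\<And>g::'a \<Rightarrow>\<^sub>L real. ((\<lambda>n. g (z n)) \<longlongrightarrow> g z') G"
    using reflexive_weak_cluster_point[OF refl, of G2 z] z G2(2) by metis
  have G_seq: "G \<le> sequentially" using G(1) G2(1) G1(1) by (meson order_trans)
  have lim_l: "((\<lambda>n. f n A) \<longlongrightarrow> l A) G" for A
    using G1(3) by (rule tendsto_mono[rotated]) (use G(1) G2(1) in \<open>rule order_trans\<close>)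
  have lim_y: "((\<lambda>n. y n v) \<longlongrightarrow> blinfun_apply y' v) G" for v
    using G2(3) G(1) by (rule tendsto_mono[rotated])
  have "l T = 1" using tendsto_unique[OF G(2) lim_l tendsto_mono[OF G_seq fT_lim]] .
  then have l_supp: "l \<in> support_functionals T"
    using l T(1) by (intro support_functionalsI(1)) auto
  have "((\<lambda>n. F S - t n) \<longlongrightarrow> F S - 0) G"
    by (intro tendsto_diff tendsto_const tendsto_mono[OF G_seq t0])
  then have lS: "F S \<le> l S"
    using tendsto_le[OF G(2) lim_l[of S], of "\<lambda>n. F S - t n" "F S"] fS_lower by simp
  \<comment> \<open>Both sides agree on compact operators; unique extension carries this to
    \<open>T\<close> and \<open>S\<close>, which may be non-compact.\<close>
  have "point_functional z' y' = l"
  proof (rule M_ideal_unique_extension[OF P])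
    show "P l = 0" using P(3,4) T(1,3,2) l_supp by (rule M_ideal_projection_support)
    show "l A = point_functional z' y' A" if "A \<in> compact_ops" for A
      using compact_op_weak_limit[OF that G(2) z G(3) y lim_y] lim_l[of A]
      by (simp add: f_def eval_blinfun.rep_eq)
    show "norm (point_functional z' y') \<le> norm l"
      using norm_point_functional_le_1[OF z' y'] l_supp by (simp add: support_functionals_def)
  qed
  then have y'z': "y' (T z') = 1" "y' (S z') = l S"
    using \<open>l T = 1\<close> by (auto simp: eval_blinfun.rep_eq)
  have T_le: "norm (T v) \<le> 1" if "norm v \<le> 1" for v
    using norm_blinfun[of T v] T(1) that by simp
  have "(y' o\<^sub>L T) v \<le> 1" if "norm v \<le> 1" for v
    using abs_blinfun_le[OF y', of "T v"] T_le[OF that] by simp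
  \<comment> \<open>\<open>y' o\<^sub>L T\<close> attains its maximum 1 over the ball at
    \<open>z'\<close>; moving to an extreme point of that face does not lower
    \<open>y' o\<^sub>L S\<close>.\<close>
  then obtain e where e: "e extreme_point_of cball 0 1" "(y' o\<^sub>L T) e = 1"
      "(y' o\<^sub>L S) z' \<le> (y' o\<^sub>L S) e"
    using reflexive_face_maximizer[OF refl, of "y' o\<^sub>L T" 1 z' "y' o\<^sub>L S"] z' y'z'(1) by auto
  have e1: "norm e \<le> 1" using e(1) by (auto simp: extreme_point_of_def)
  have supp: "y' \<in> support_functionals (T e)" "norm (T e) = 1"
    using support_functionalsI[OF y' T_le[OF e1]] e(2) by auto
  then have "norm e = 1" using norm_blinfun[of T e] T(1) e1 by simp
  then have "e \<in> norm_attain_set T" using supp(2) T(1) by (simp add: norm_attain_set_def)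
  then show thesis using that[OF e(1) _ supp(1)] lS y'z'(2) e(3) by simp
qed

section \<open>Dimension count for the span of the support functionals of \<open>T\<close>\<close>

lemma k_smooth_basis:
  assumes "k_smooth z k"
  obtains B where "finite B" "independent B" "span B = span (support_functionals z)" "card B = k"
proof -
  obtain C where C: "finite C" "span C = span (support_functionals z)"
    and dim: "dim (span (support_functionals z)) = k"
    using assms by (auto simp: k_smooth_def)
  \<comment> \<open>Picked inside a finite set, the basis is finite; for an infinite basis
    \<open>card\<close>, hence \<open>dim\<close>, would be 0.\<close>
  obtain B where B: "B \<subseteq> C" "independent B" "C \<subseteq> span B"
    using maximal_independent_subset by blast
  have "span B = span C" using B by (meson span_minimal span_mono subset_antisym subspace_span)
  moreover have "dim (span B) = card B" using B(2) by (rule dim_span_eq_card_independent)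
  moreover have "finite B" using B(1) C(1) by (rule finite_subset)
  ultimately show thesis using that[of B] B(2) C(2) dim by metis
qed

theorem theorem3p2:
  fixes T :: "'a::banach \<Rightarrow>\<^sub>L 'b::banach"
    and x :: "nat \<Rightarrow> 'a" and m :: "nat \<Rightarrow> nat" and r :: nat
  assumes "reflexive_space TYPE('a)"
    and "M_ideal (compact_ops :: ('a \<Rightarrow>\<^sub>L 'b) set)"
    and "norm T = 1"
    and "infdist T compact_ops < 1"
    and "1 \<le> r"
    and "norm_attain_set T \<inter> {e. e extreme_point_of cball 0 1}
           = {y. \<exists>i\<in>{1..r}. y = x i \<or> y = - x i}"
    and "inj_on x {1..r}"
    and "independent (x ` {1..r})"
    and "\<And>i. i \<in> {1..r} \<Longrightarrow> k_smooth (blinfun_apply T (x i)) (m i)"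
  shows "k_smooth T (\<Sum>i=1..r. m i)"
proof -
  let ?K = "compact_ops :: ('a \<Rightarrow>\<^sub>L 'b) set"
  let ?J = "support_functionals T"
  obtain P :: "(('a \<Rightarrow>\<^sub>L 'b) \<Rightarrow>\<^sub>L real) \<Rightarrow> (('a \<Rightarrow>\<^sub>L 'b) \<Rightarrow>\<^sub>L real)"
    where P: "linear P" "P \<circ> P = P" "range P = {f. \<forall>m\<in>?K. blinfun_apply f m = 0}"
      "\<And>f. norm f = norm (P f) + norm (f - P f)"
    using assms(2) unfolding M_ideal_def by blast
  have K: "subspace ?K" using assms(2) by (simp add: M_ideal_def)
  have K_ne: "?K \<noteq> {}" using subspace_0[OF K] by blast
  have P_J: "P f = 0" if "f \<in> ?J" for f
    using P(3,4) assms(3) K_ne assms(4) that by (rule M_ideal_projection_support)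
  have "\<forall>i\<in>{1..r}. \<exists>B. finite B \<and> independent B \<and> span B = span (support_functionals (T (x i))) \<and> card B = m i"
    using k_smooth_basis[OF assms(9)] by metis
  then obtain B where B: "\<And>i. i \<in> {1..r} \<Longrightarrow> finite (B i)" "\<And>i. i \<in> {1..r} \<Longrightarrow> independent (B i)"
      "\<And>i. i \<in> {1..r} \<Longrightarrow> span (B i) = span (support_functionals (T (x i)))"
      "\<And>i. i \<in> {1..r} \<Longrightarrow> card (B i) = m i"
    by metis
  \<comment> \<open>The bases at the points \<open>x i\<close>, carried over to functionals on
    operators; they turn out to form a basis of \<open>span ?J\<close>.\<close>
  let ?W = "\<Union>i\<in>{1..r}. point_functional (x i) ` B i"
  have finW: "finite ?W" using B(1) by blast
  have W: "independent ?W" "card ?W = (\<Sum>i=1..r. m i)"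
  proof -
    have direct: "c i = 0" if "(\<Sum>i=1..r. point_functional (x i) (c i)) = 0" "i \<in> {1..r}"
      for c :: "nat \<Rightarrow> 'b \<Rightarrow>\<^sub>L real" and i
      using point_functionals_direct[OF _ assms(7,8) that(2,1)] by simp
    show "independent ?W"
      by (rule direct_sum_independent(1))
        (use direct B linear_point_functional in auto)
    have "card ?W = (\<Sum>i=1..r. card (B i))"
      by (rule direct_sum_independent(2))
        (use direct B linear_point_functional in auto)
    then show "card ?W = (\<Sum>i=1..r. m i)" by (simp add: B(4))
  qed
  have x: "norm (x i) = 1" if "i \<in> {1..r}" for i
  proof -
    have "x i \<in> norm_attain_set T" using assms(6) that by blast
    then show ?thesis by (simp add: norm_attain_set_def)
  qed
  have W_J: "?W \<subseteq> span ?J"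
  proof (intro UN_least)
    fix i assume i: "i \<in> {1..r}"
    have "point_functional (x i) ` B i \<subseteq> point_functional (x i) ` span (support_functionals (T (x i)))"
      using B(3)[OF i] span_superset by blast
    also have "\<dots> = span (point_functional (x i) ` support_functionals (T (x i)))"
      by (rule linear_span_image[OF linear_point_functional, symmetric])
    also have "\<dots> \<subseteq> span ?J"
      using point_functional_support[OF assms(3)] x[OF i] by (intro span_mono) auto
    finally show "point_functional (x i) ` B i \<subseteq> span ?J" .
  qed
  have P_span: "P g = 0" if "g \<in> span ?J" for g
    using linear_eq_0_on_span[OF P(1) P_J that] .
  have J_W: "?J \<subseteq> span ?W"
  proof
    fix F assume F: "F \<in> ?J"
    \<comment> \<open>The extreme point may change with \<open>S\<close>, so only an upper bound
      comes out; replacing \<open>S\<close> by \<open>- S\<close> gives equality.\<close>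
    have le: "F S \<le> 0" if S: "\<And>g. g \<in> ?W \<Longrightarrow> blinfun_apply g S = 0" for S
    proof -
      obtain z f where z: "z extreme_point_of cball 0 1" "z \<in> norm_attain_set T"
          and f: "f \<in> support_functionals (T z)" "F S \<le> f (S z)"
        using support_functional_dominated_at_extreme_point[OF assms(1) P assms(3,4) K_ne F] by blast
      then obtain i where i: "i \<in> {1..r}" "z = x i \<or> z = - x i" using assms(6) by blast
      have vanish: "g (S (x i)) = 0" if "g \<in> support_functionals (T (x i))" for g
      proof -
        have "linear (\<lambda>g. blinfun_apply g (S (x i)))"
          by (rule linearI) (auto simp: blinfun.add_left blinfun.scaleR_left)
        moreover have "blinfun_apply b (S (x i)) = 0" if "b \<in> B i" for b
        proof -
          have "point_functional (x i) b \<in> ?W" using i(1) that by blast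
          then have "point_functional (x i) b S = 0" by (rule S)
          then show ?thesis by (simp add: eval_blinfun.rep_eq)
        qed
        moreover have "g \<in> span (B i)" using B(3)[OF i(1)] that by (simp add: span_base)
        ultimately show ?thesis by (rule linear_eq_0_on_span)
      qed
      have "f (S z) = 0"
      proof (cases "z = x i")
        case True
        then show ?thesis using vanish f(1) by simp
      next
        case False
        then have "z = - x i" using i(2) by simp
        \<comment> \<open>The sign of the point is absorbed by the functional, so
          \<open>\<plusminus>x i\<close> share the same family of tensors.\<close>
        then have "- f \<in> support_functionals (T (x i))"
          using f(1) by (simp add: support_functionals_def blinfun.minus_left blinfun.minus_right)
        then show ?thesis using vanish[of "- f"] \<open>z = - x i\<close>
          by (simp add: blinfun.minus_left blinfun.minus_right)
      qed
      then show ?thesis using f(2) by simp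
    qed
    have "F S = 0" if "\<And>g. g \<in> ?W \<Longrightarrow> blinfun_apply g S = 0" for S
      using le[of S] le[of "- S"] that by (force simp: blinfun.minus_right)
    then obtain g where g: "g \<in> span ?W" "\<And>S. S \<in> ?K \<Longrightarrow> F S = g S"
      using functional_in_span[OF finW K, of F] by blast
    \<comment> \<open>\<open>P\<close> kills both \<open>F\<close> and \<open>g\<close>, yet fixes
      \<open>F - g\<close>, which vanishes on compact operators; hence \<open>F = g\<close> on all
      operators.\<close>
    have "g \<in> span ?J" using g(1) span_minimal[OF W_J subspace_span] by blast
    then have "P (F - g) = 0" using P_J[OF F] P_span[of g] linear_diff[OF P(1)] by simp
    moreover have "F - g \<in> range P" unfolding P(3) using g(2) by (simp add: blinfun.diff_left)
    then have "P (F - g) = F - g" using P(2) by (metis comp_apply imageE)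
    ultimately show "F \<in> span ?W" using g(1) by simp
  qed
  have eq: "span ?W = span ?J"
    using span_minimal[OF W_J subspace_span] span_minimal[OF J_W subspace_span] by (rule subset_antisym)
  have "dim (span ?J) = (\<Sum>i=1..r. m i)"
    unfolding eq[symmetric] dim_span_eq_card_independent[OF W(1)] by (rule W(2))
  with assms(3) finW eq show ?thesis unfolding k_smooth_def by (intro conjI exI[of _ ?W])
qed

end
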